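(* Let $\mathcal{X}$ and $\mathcal{Y}$ be nonempty finite sets and let $(n_x)_{x\in\mathcal{X}}$, $(m_y)_{y\in\mathcal{Y}}$ be positive masses with $\sum_{x\in\mathcal{X}}n_x=\sum_{y\in\mathcal{Y}}m_y$. For each $x\in\mathcal{X}$, $y\in\mathcal{Y}$ let $M_{xy}:\mathbb{R}^2\to\mathbb{R}$, $(a_x,b_y)\mapsto M_{xy}(a_x,b_y)$, satisfy: (i) $M_{xy}$ is continuous; (ii) $M_{xy}$ is strictly isotone (strictly increasing in each argument); (iii) for each $a_x\in\mathbb{R}$, $\lim_{b_y\to-\infty}M_{xy}(a_x,b_y)=0$ and $\lim_{b_y\to+\infty}M_{xy}(a_x,b_y)=+\infty$; and for each $b_y\in\mathbb{R}$, $\lim_{a_x\to-\infty}M_{xy}(a_x,b_y)=0$ and $\lim_{a_x\to+\infty}M_{xy}(a_x,b_y)=+\infty$. Let $\psi:\mathbb{R}^{|\mathcal{X}|+|\mathcal{Y}|}\to\mathbb{R}$ be a normalization mapping with bounds $L_\psi,U_\psi$, and let $K\in(L_\psi,U_\psi)$. Then there exists a unique matching equilibrium with full assignment under the normalization $\psi(-a^*,b^* )=K$; it is given by $\mu_{xy}=M_{xy}(a_x^*,b_y^* )$, where the pair of vectors $a^*=(a_x^* )_{x\in\mathcal{X}}$, $b^*=(b_y^* )_{y\in\mathcal{Y}}$ is the unique solution of the system $$\begin{cases} n_x=\sum_{y\in\mathcal{Y}}M_{xy}(a_x,b_y), & x\in\mathcal{X},\\ m_y=\sum_{x\in\mathcal{X}}M_{xy}(a_x,b_y),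 & y\in\mathcal{Y},\\ \psi(-a,b)=K.\end{cases}$$ Moreover, the fixed effects $(a_x^* )_{x\in\mathcal{X}}$ are decreasing in $K$ and the fixed effects $(b_y^* )_{y\in\mathcal{Y}}$ are increasing in $K$.
   Context: A matching function equilibrium with full assignment is an array $(\mu_{xy})$ of the form $\mu_{xy}=M_{xy}(a_x,b_y)$, where the fixed effects $a=(a_x)$, $b=(b_y)$ satisfy the accounting equations $n_x=\sum_yM_{xy}(a_x,b_y)$ for all $x\in\mathcal{X}$ and $m_y=\sum_xM_{xy}(a_x,b_y)$ for all $y\in\mathcal{Y}$, and the balance equation $\sum_xn_x=\sum_ym_y=\sum_{xy}\mu_{xy}$ holds. Normalization mapping: with $\mathcal{Z}=\mathcal{X}\cup\mathcal{Y}$ (disjoint union) and $p=(p_z)_{z\in\mathcal{Z}}$, where $p_x=-a_x$ and $p_y=b_y$, the map $\psi:\mathbb{R}^{|\mathcal{Z}|}\to\mathbb{R}$ (i) is continuous; (ii) is weakly increasing in each $p_z$; (iii) satisfies $\psi(p)\to L_\psi$ when $p_z\to-\infty$ for all $z\in\mathcal{Z}$; (iv) satisfies $\psi(p)\to U_\psi$ when $p_z\to+\infty$ for all $z\in\mathcal{Z}$; (v) satisfies $\psi(p+t1_{\mathcal{Z}})=\psi(p)+t$ for all $t\in\mathbb{R}$, where $1_{\mathcal{Z}}$ is the all-ones vector. (Thus $L_\psi=-\infty$ and $U_\psi=+\infty$.) *)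

theory Defs
  imports "HOL-Analysis.Analysis"
begin

definition strictly_isotone :: "(real \<Rightarrow> real \<Rightarrow> real) \<Rightarrow> bool" where
  "strictly_isotone f \<longleftrightarrow>
     (\<forall>s. strict_mono (\<lambda>t. f s t)) \<and> (\<forall>t. strict_mono (\<lambda>s. f s t))"

definition limit_conditions :: "(real \<Rightarrow> real \<Rightarrow> real) \<Rightarrow> bool" where
  "limit_conditions f \<longleftrightarrow>
     (\<forall>s. ((\<lambda>t. f s t) \<longlongrightarrow> 0) at_bot \<and> filterlim (\<lambda>t. f s t) at_top at_top) \<and>
     (\<forall>t. ((\<lambda>s. f s t) \<longlongrightarrow> 0) at_bot \<and> filterlim (\<lambda>s. f s t) at_top at_top)"

definition matching_function :: "(real \<Rightarrow> real \<Rightarrow> real) \<Rightarrow> bool" where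
  "matching_function f \<longleftrightarrow>
     continuous_on UNIV (\<lambda>(s, t). f s t) \<and> strictly_isotone f \<and> limit_conditions f"

text \<open>The order on \<^typ>\<open>real ^ 'z\<close> is componentwise, so \<^term>\<open>at_bot\<close> and \<^term>\<open>at_top\<close> are
  the filters of all coordinates tending jointly to minus, respectively plus, infinity
  (spelled out in the next two lemmas).\<close>

lemma eventually_at_bot_vec:
  fixes P :: "real ^ 'z::finite \<Rightarrow> bool"
  shows "eventually P at_bot \<longleftrightarrow> (\<exists>c::real. \<forall>p. (\<forall>z. p $ z \<le> c) \<longrightarrow> P p)"
proof -
  have "eventually P at_bot \<longleftrightarrow> (\<exists>k\<in>UNIV. eventually P (principal {..k}))"
    unfolding at_bot_def
  proof (rule eventually_INF_base)
    fix k l :: "real ^ 'z"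
    have "(\<chi> z. min (k $ z) (l $ z)) \<le> k" "(\<chi> z. min (k $ z) (l $ z)) \<le> l"
      by (simp_all add: less_eq_vec_def)
    then show "\<exists>m\<in>UNIV. principal {..m} \<le> inf (principal {..k}) (principal {..l})"
      by (intro bexI[of _ "\<chi> z. min (k $ z) (l $ z)"]) (auto intro: order_trans)
  qed simp
  also have "\<dots> \<longleftrightarrow> (\<exists>k. \<forall>p\<le>k. P p)"
    by (auto simp: eventually_principal)
  also have "\<dots> \<longleftrightarrow> (\<exists>c::real. \<forall>p. (\<forall>z. p $ z \<le> c) \<longrightarrow> P p)"
  proof
    assume "\<exists>k. \<forall>p\<le>k. P p"
    then obtain k where k: "\<forall>p\<le>k. P p" by blast
    have "P p" if "\<forall>z. p $ z \<le> Min (range (($) k))" for p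
    proof -
      have "Min (range (($) k)) \<le> k $ z" for z by (rule Min_le) auto
      then have "p \<le> k" using that unfolding less_eq_vec_def by (meson order_trans)
      then show ?thesis using k by blast
    qed
    then show "\<exists>c::real. \<forall>p. (\<forall>z. p $ z \<le> c) \<longrightarrow> P p" by blast
  next
    assume "\<exists>c::real. \<forall>p. (\<forall>z. p $ z \<le> c) \<longrightarrow> P p"
    then obtain c :: real where "\<forall>p. (\<forall>z. p $ z \<le> c) \<longrightarrow> P p" by blast
    then show "\<exists>k. \<forall>p\<le>k. P p"
      by (intro exI[of _ "\<chi> z. c"]) (simp add: less_eq_vec_def)
  qed
  finally show ?thesis .
qed

lemma eventually_at_top_vec:
  fixes P :: "real ^ 'z::finite \<Rightarrow> bool"
  shows "eventually P at_top \<longleftrightarrow> (\<exists>c::real. \<forall>p. (\<forall>z. c \<le> p $ z) \<longrightarrow> P p)"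
proof -
  have "eventually P at_top \<longleftrightarrow> (\<exists>k\<in>UNIV. eventually P (principal {k..}))"
    unfolding at_top_def
  proof (rule eventually_INF_base)
    fix k l :: "real ^ 'z"
    have "k \<le> (\<chi> z. max (k $ z) (l $ z))" "l \<le> (\<chi> z. max (k $ z) (l $ z))"
      by (simp_all add: less_eq_vec_def)
    then show "\<exists>m\<in>UNIV. principal {m..} \<le> inf (principal {k..}) (principal {l..})"
      by (intro bexI[of _ "\<chi> z. max (k $ z) (l $ z)"]) (auto intro: order_trans)
  qed simp
  also have "\<dots> \<longleftrightarrow> (\<exists>k. \<forall>p\<ge>k. P p)"
    by (auto simp: eventually_principal)
  also have "\<dots> \<longleftrightarrow> (\<exists>c::real. \<forall>p. (\<forall>z. c \<le> p $ z) \<longrightarrow> P p)"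
  proof
    assume "\<exists>k. \<forall>p\<ge>k. P p"
    then obtain k where k: "\<forall>p\<ge>k. P p" by blast
    have "P p" if "\<forall>z. Max (range (($) k)) \<le> p $ z" for p
    proof -
      have "k $ z \<le> Max (range (($) k))" for z by (rule Max_ge) auto
      then have "k \<le> p" using that unfolding less_eq_vec_def by (meson order_trans)
      then show ?thesis using k by blast
    qed
    then show "\<exists>c::real. \<forall>p. (\<forall>z. c \<le> p $ z) \<longrightarrow> P p" by blast
  next
    assume "\<exists>c::real. \<forall>p. (\<forall>z. c \<le> p $ z) \<longrightarrow> P p"
    then obtain c :: real where "\<forall>p. (\<forall>z. c \<le> p $ z) \<longrightarrow> P p" by blast
    then show "\<exists>k. \<forall>p\<ge>k. P p"
      by (intro exI[of _ "\<chi> z. c"]) (simp add: less_eq_vec_def)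
  qed
  finally show ?thesis .
qed

definition normalization_mapping :: "(real ^ 'z::finite \<Rightarrow> real) \<Rightarrow> ereal \<Rightarrow> ereal \<Rightarrow> bool" where
  "normalization_mapping \<psi> L U \<longleftrightarrow>
     continuous_on UNIV \<psi> \<and>
     (\<forall>z p. mono (\<lambda>t. \<psi> (\<chi> w. if w = z then t else p $ w))) \<and>
     ((\<lambda>p. ereal (\<psi> p)) \<longlongrightarrow> L) at_bot \<and>
     ((\<lambda>p. ereal (\<psi> p)) \<longlongrightarrow> U) at_top \<and>
     (\<forall>p t. \<psi> (p + t *\<^sub>R (\<chi> z. 1)) = \<psi> p + t)"

text \<open>The vector \<open>(- a, b)\<close>, indexed by the disjoint union of the two sides of the market.\<close>

definition price_vector :: "real ^ 'x::finite \<Rightarrow> real ^ 'y::finite \<Rightarrow> real ^ ('x + 'y)" where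
  "price_vector a b = (\<chi> z. case z of Inl x \<Rightarrow> - (a $ x) | Inr y \<Rightarrow> b $ y)"

definition accounting_equations ::
  "real ^ 'x::finite \<Rightarrow> real ^ 'y::finite \<Rightarrow> ('x \<Rightarrow> 'y \<Rightarrow> real \<Rightarrow> real \<Rightarrow> real) \<Rightarrow>
   real ^ 'x \<Rightarrow> real ^ 'y \<Rightarrow> bool" where
  "accounting_equations n m M a b \<longleftrightarrow>
     (\<forall>x. n $ x = (\<Sum>y\<in>UNIV. M x y (a $ x) (b $ y))) \<and>
     (\<forall>y. m $ y = (\<Sum>x\<in>UNIV. M x y (a $ x) (b $ y)))"

definition normalized_system ::
  "real ^ 'x::finite \<Rightarrow> real ^ 'y::finite \<Rightarrow> ('x \<Rightarrow> 'y \<Rightarrow> real \<Rightarrow> real \<Rightarrow> real) \<Rightarrow>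
   (real ^ ('x + 'y) \<Rightarrow> real) \<Rightarrow> real \<Rightarrow> real ^ 'x \<Rightarrow> real ^ 'y \<Rightarrow> bool" where
  "normalized_system n m M \<psi> K a b \<longleftrightarrow>
     accounting_equations n m M a b \<and> \<psi> (price_vector a b) = K"

definition equilibrium_with_effects ::
  "real ^ 'x::finite \<Rightarrow> real ^ 'y::finite \<Rightarrow> ('x \<Rightarrow> 'y \<Rightarrow> real \<Rightarrow> real \<Rightarrow> real) \<Rightarrow>
   real ^ 'x \<Rightarrow> real ^ 'y \<Rightarrow> ('x \<Rightarrow> 'y \<Rightarrow> real) \<Rightarrow> bool" where
  "equilibrium_with_effects n m M a b \<mu> \<longleftrightarrow>
     (\<forall>x y. \<mu> x y = M x y (a $ x) (b $ y)) \<and>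
     accounting_equations n m M a b \<and>
     (\<Sum>x\<in>UNIV. n $ x) = (\<Sum>y\<in>UNIV. m $ y) \<and>
     (\<Sum>y\<in>UNIV. m $ y) = (\<Sum>x\<in>UNIV. \<Sum>y\<in>UNIV. \<mu> x y)"

definition normalized_equilibrium ::
  "real ^ 'x::finite \<Rightarrow> real ^ 'y::finite \<Rightarrow> ('x \<Rightarrow> 'y \<Rightarrow> real \<Rightarrow> real \<Rightarrow> real) \<Rightarrow>
   (real ^ ('x + 'y) \<Rightarrow> real) \<Rightarrow> real \<Rightarrow> ('x \<Rightarrow> 'y \<Rightarrow> real) \<Rightarrow> bool" where
  "normalized_equilibrium n m M \<psi> K \<mu> \<longleftrightarrow>
     (\<exists>a b. equilibrium_with_effects n m M a b \<mu> \<and> \<psi> (price_vector a b) = K)"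

end

theory Submission
  imports Defs
begin

text \<open>In the prices \<open>p = (- a, b)\<close> the market is an excess supply system with gross substitutes
  whose components sum to zero by balance.  Hence the join of two solutions, being a
  subsolution, is again a solution; as the system is strictly monotone and every pair of sides
  interacts, two distinct solutions are strictly ordered in all coordinates.  This gives
  uniqueness and monotonicity in \<open>K\<close>.  For existence, fix one price; a supersolution minimising
  the total of the others is a solution.  The solutions thus form a closed chain on which every
  coordinate takes every value, and \<open>\<psi>\<close> takes the value \<open>K\<close> on it because it changes sign
  relative to \<open>K\<close> along the chain, which projects onto a (connected) line.\<close>

section \<open>Normalization mappings and strictly ordered chains\<close>

text \<open>The definition gives monotonicity in one coordinate at a time. The induction replaces
  the coordinates of \<open>p\<close> by those of \<open>q\<close> one after another;
  \<open>A\<close> is the set already replaced.\<close>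

lemma normalization_mono:
  fixes \<psi> :: "real ^ 'z::finite \<Rightarrow> real"
  assumes \<psi>: "normalization_mapping \<psi> L U" and "p \<le> q"
  shows "\<psi> p \<le> \<psi> q"
proof -
  have "\<psi> p \<le> \<psi> (\<chi> w. if w \<in> A then q $ w else p $ w)" if "finite A" for A :: "'z set"
    using that
  proof (induction A)
    case empty
    then show ?case by simp
  next
    case (insert z A)
    let ?r = "\<chi> w. if w \<in> A then q $ w else p $ w"
    have eq1: "(\<chi> w. if w = z then p $ z else ?r $ w) = ?r"
      using insert.hyps by (auto simp: vec_eq_iff)
    have eq2: "(\<chi> w. if w = z then q $ z else ?r $ w)
        = (\<chi> w. if w \<in> insert z A then q $ w else p $ w)"
      by (auto simp: vec_eq_iff)
    have "mono (\<lambda>t. \<psi> (\<chi> w. if w = z then t else ?r $ w))"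
      using \<psi> unfolding normalization_mapping_def by blast
    moreover have "p $ z \<le> q $ z"
      using \<open>p \<le> q\<close> by (simp add: less_eq_vec_def)
    ultimately have "\<psi> (\<chi> w. if w = z then p $ z else ?r $ w)
        \<le> \<psi> (\<chi> w. if w = z then q $ z else ?r $ w)"
      by (rule monoD)
    then show ?case using insert.IH unfolding eq1 eq2 by linarith
  qed
  from this[of UNIV] show ?thesis by simp
qed

lemma normalization_shift:
  assumes "normalization_mapping \<psi> L U"
  shows "\<psi> (p + t *\<^sub>R (\<chi> z. 1)) = \<psi> p + t"
  using assms unfolding normalization_mapping_def by blast

text \<open>Strictness comes from translation: with \<open>t\<close> the least coordinate gap,
  \<open>p\<close> shifted up by \<open>t\<close> still lies below \<open>q\<close>, and the shift
  alone adds \<open>t > 0\<close> to the value.\<close>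

lemma normalization_strict_mono:
  fixes \<psi> :: "real ^ 'z::finite \<Rightarrow> real"
  assumes \<psi>: "normalization_mapping \<psi> L U" and less: "\<And>z. p $ z < q $ z"
  shows "\<psi> p < \<psi> q"
proof -
  define t where "t = Min (range (\<lambda>z. q $ z - p $ z))"
  have "t > 0" unfolding t_def using less by (subst Min_gr_iff) auto
  have "t \<le> q $ z - p $ z" for z unfolding t_def by (rule Min_le) auto
  then have "p + t *\<^sub>R (\<chi> z. 1) \<le> q"
    by (simp add: less_eq_vec_def) (smt (verit))
  then have "\<psi> p + t \<le> \<psi> q"
    using normalization_mono[OF \<psi>] normalization_shift[OF \<psi>] by metis
  then show ?thesis using \<open>t > 0\<close> by simp
qed

text \<open>For each \<open>z\<close> choose a member \<open>f z\<close> whose coordinate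
  \<open>z\<close> equals \<open>d\<close>. In a chain a single coordinate \<open>w\<close> decides
  the order, so the chosen member with least (greatest) coordinate \<open>w\<close> is below (above)
  every \<open>f z\<close>, hence at most (at least) \<open>d\<close> in each coordinate.\<close>

lemma strict_chain_extremum:
  fixes S :: "(real ^ 'z::finite) set"
  assumes chain: "\<And>p q. p \<in> S \<Longrightarrow> q \<in> S \<Longrightarrow>
      p = q \<or> (\<forall>z. p $ z < q $ z) \<or> (\<forall>z. q $ z < p $ z)"
    and hits: "\<And>z d. \<exists>p\<in>S. p $ z = d"
  shows "\<exists>p\<in>S. \<forall>z. p $ z \<le> d" and "\<exists>p\<in>S. \<forall>z. d \<le> p $ z"
proof -
  obtain f where f: "\<And>z. f z \<in> S" "\<And>z. f z $ z = d"
    using hits[of _ d] by metis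
  fix w :: 'z
  let ?V = "range (\<lambda>z. f z $ w)"
  have "Min ?V \<in> ?V" "Max ?V \<in> ?V" by (rule Min_in Max_in; simp)+
  then obtain u v where uv: "f u $ w = Min ?V" "f v $ w = Max ?V" by force
  have "f u $ w \<le> f z $ w" "f z $ w \<le> f v $ w" for z unfolding uv by simp_all
  moreover have "p $ z \<le> q $ z" if "p \<in> S" "q \<in> S" "p $ w \<le> q $ w" for p q z
    using chain[OF that(1,2)] that(3) by (auto simp: less_imp_le dest: spec[of _ w])
  ultimately have "f u $ z \<le> d" "d \<le> f v $ z" for z
    using f by metis+
  then show "\<exists>p\<in>S. \<forall>z. p $ z \<le> d" "\<exists>p\<in>S. \<forall>z. d \<le> p $ z"
    using f(1) by blast+
qed

text \<open>An intermediate value theorem on \<open>S\<close>. Connectedness is borrowed from an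
  interval: coordinate \<open>w\<close> is injective on the chain and takes every real
  value.\<close>

lemma normalization_hits_strict_chain:
  fixes S :: "(real ^ 'z::finite) set"
  assumes \<psi>: "normalization_mapping \<psi> L U"
    and "closed S"
    and chain: "\<And>p q. p \<in> S \<Longrightarrow> q \<in> S \<Longrightarrow>
      p = q \<or> (\<forall>z. p $ z < q $ z) \<or> (\<forall>z. q $ z < p $ z)"
    and hits: "\<And>z d. \<exists>p\<in>S. p $ z = d"
  shows "\<exists>p\<in>S. \<psi> p = K"
proof -
  \<comment> \<open>The constant vector \<open>d\<close> has value \<open>K\<close>, so members of
    \<open>S\<close> below or above it have values on the corresponding side of
    \<open>K\<close>.\<close>
  define d where "d = K - \<psi> 0"
  have d: "\<psi> (\<chi> z. d) = K"
    using normalization_shift[OF \<psi>, of 0 d] unfolding d_def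
    by (simp add: scaleR_vec_def)
  obtain l where l: "l \<in> S" "\<And>z. l $ z \<le> d"
    using strict_chain_extremum(1)[OF chain hits] by blast
  obtain h where h: "h \<in> S" "\<And>z. d \<le> h $ z"
    using strict_chain_extremum(2)[OF chain hits] by blast
  have "\<psi> l \<le> K" "K \<le> \<psi> h"
    using l(2) h(2) normalization_mono[OF \<psi>] d
    by (metis (no_types, lifting) less_eq_vec_def vec_lambda_beta)+
  have "l \<le> h" using l(2) h(2) unfolding less_eq_vec_def by (meson order_trans)
  fix w :: 'z
  let ?A = "{p. \<psi> p \<le> K}" and ?B = "{p. K \<le> \<psi> p}"
  \<comment> \<open>Cutting \<open>S\<close> down to the box between \<open>l\<close> and
    \<open>h\<close> makes the projected set compact, so that its image is closed.\<close>
  define pr where "pr C = (\<lambda>p. p $ w) ` (S \<inter> cbox l h \<inter> C)" for C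
  have cont: "continuous_on UNIV \<psi>"
    using \<psi> unfolding normalization_mapping_def by blast
  have "closed ?A" "closed ?B"
    using cont by (intro closed_Collect_le; simp)+
  moreover have "closed (pr C)" if "closed C" for C
  proof -
    have "compact (S \<inter> cbox l h \<inter> C)"
      by (rule compact_Int_closed[OF closed_Int_compact[OF \<open>closed S\<close> compact_cbox] that])
    then show ?thesis unfolding pr_def
      by (intro compact_imp_closed compact_continuous_image continuous_intros)
  qed
  ultimately have clo: "closed (pr ?A)" "closed (pr ?B)" by simp_all
  have cover: "{l $ w..h $ w} \<subseteq> pr ?A \<union> pr ?B"
  proof
    fix c assume c: "c \<in> {l $ w..h $ w}"
    obtain p where p: "p \<in> S" "p $ w = c" using hits by blast
    have "l \<le> p" "p \<le> h"
      using chain[OF l(1) p(1)] chain[OF p(1) h(1)] c p(2)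
      by (auto simp: less_eq_vec_def less_imp_le dest: spec[of _ w])
    then have "p \<in> cbox l h" by (auto simp: less_eq_vec_def mem_box_cart)
    then show "c \<in> pr ?A \<union> pr ?B"
      using p unfolding pr_def by (cases "\<psi> p \<le> K") auto
  qed
  have "l \<in> cbox l h" "h \<in> cbox l h"
    using \<open>l \<le> h\<close> by (auto simp: less_eq_vec_def mem_box_cart)
  then have "l $ w \<in> pr ?A \<inter> {l $ w..h $ w}" "h $ w \<in> pr ?B \<inter> {l $ w..h $ w}"
    using \<open>l \<le> h\<close> l(1) h(1) \<open>\<psi> l \<le> K\<close> \<open>K \<le> \<psi> h\<close>
    unfolding pr_def by (auto simp: less_eq_vec_def)
  moreover have "connected {l $ w..h $ w}" by simp
  ultimately have "pr ?A \<inter> pr ?B \<inter> {l $ w..h $ w} \<noteq> {}"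
    using clo cover unfolding connected_closed by blast
  then obtain p q where pq: "p \<in> S" "q \<in> S" "\<psi> p \<le> K" "K \<le> \<psi> q" "p $ w = q $ w"
    unfolding pr_def by auto
  \<comment> \<open>A shared coordinate rules out both strict orders in the chain.\<close>
  then have "p = q" using chain[OF pq(1,2)] by (metis order_less_irrefl)
  then show ?thesis using pq by force
qed

section \<open>Auxiliary facts on sums, small perturbations and price vectors\<close>

lemma sum_less_if_less_div_card:
  fixes f :: "'i::finite \<Rightarrow> real"
  assumes "\<And>i. f i < C / real CARD('i)"
  shows "(\<Sum>i\<in>UNIV. f i) < C"
proof -
  have "(\<Sum>i\<in>UNIV. f i) < (\<Sum>i\<in>(UNIV :: 'i set). C / real CARD('i))"
    by (rule sum_strict_mono) (auto intro: assms)
  then show ?thesis by simp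
qed

lemma exists_increase_below:
  fixes f :: "real \<Rightarrow> real"
  assumes "continuous_on UNIV f" "f s < C"
  shows "\<exists>r>s. f r < C"
proof -
  have "(f \<longlongrightarrow> f s) (at_right s)"
    using assms(1) by (metis UNIV_I continuous_on_def tendsto_within_subset top_greatest)
  then have "eventually (\<lambda>r. f r < C) (at_right s)"
    using assms(2) by (rule order_tendstoD)
  then have "eventually (\<lambda>r. f r < C \<and> r > s) (at_right s)"
    using eventually_at_right_less[of s] by eventually_elim simp
  from eventually_happens[OF this] show ?thesis by auto
qed

lemma exists_decrease_above:
  fixes f :: "real \<Rightarrow> real"
  assumes "continuous_on UNIV f" "C < f s"
  shows "\<exists>r<s. C < f r"
proof -
  have "(f \<longlongrightarrow> f s) (at_left s)"
    using assms(1) by (metis UNIV_I continuous_on_def tendsto_within_subset top_greatest)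
  then have "eventually (\<lambda>r. C < f r) (at_left s)"
    using assms(2) by (rule order_tendstoD)
  then have "eventually (\<lambda>r. C < f r \<and> r < s) (at_left s)"
    using eventually_at_left_real[of "s - 1" s] by (auto elim: eventually_elim2)
  from eventually_happens[OF this] show ?thesis by auto
qed

lemma all_sum: "(\<forall>z. P z) \<longleftrightarrow> (\<forall>x. P (Inl x)) \<and> (\<forall>y. P (Inr y))"
  by (metis sum.exhaust)

lemma price_vector_inverse:
  "(\<chi> x. - (price_vector a b $ Inl x)) = a" "(\<chi> y. price_vector a b $ Inr y) = b"
  by (simp_all add: price_vector_def vec_eq_iff)

lemma price_vector_of_effects: "price_vector (\<chi> x. - (p $ Inl x)) (\<chi> y. p $ Inr y) = p"
  by (simp add: price_vector_def vec_eq_iff split: sum.split)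

section \<open>Matching markets and elementary properties of the matching functions\<close>

locale matching_market =
  fixes n :: "real ^ 'x::finite" and m :: "real ^ 'y::finite"
    and M :: "'x \<Rightarrow> 'y \<Rightarrow> real \<Rightarrow> real \<Rightarrow> real"
  assumes n_pos: "\<And>x. n $ x > 0" and m_pos: "\<And>y. m $ y > 0"
    and balance: "(\<Sum>x\<in>UNIV. n $ x) = (\<Sum>y\<in>UNIV. m $ y)"
    and matching: "\<And>x y. matching_function (M x y)"
begin

lemma M_less_left: "s < s' \<Longrightarrow> M x y s t < M x y s' t"
  using matching[of x y]
  by (auto simp: matching_function_def strictly_isotone_def strict_mono_def)

lemma M_less_right: "t < t' \<Longrightarrow> M x y s t < M x y s t'"
  using matching[of x y]
  by (auto simp: matching_function_def strictly_isotone_def strict_mono_def)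

lemma M_mono: "s \<le> s' \<Longrightarrow> t \<le> t' \<Longrightarrow> M x y s t \<le> M x y s' t'"
  using M_less_left[of s s' x y t] M_less_right[of t t' x y s'] by fastforce

lemma M_continuous [continuous_intros]:
  assumes "continuous_on A f" "continuous_on A g"
  shows "continuous_on A (\<lambda>p. M x y (f p) (g p))"
proof -
  have "continuous_on UNIV (\<lambda>(s, t). M x y s t)"
    using matching unfolding matching_function_def by blast
  from continuous_on_compose2[OF this continuous_on_Pair[OF assms]] show ?thesis by simp
qed

lemma eventually_M_less_left: "e > 0 \<Longrightarrow> eventually (\<lambda>s. M x y s t < e) at_bot"
  using matching[of x y] unfolding matching_function_def limit_conditions_def
  by (auto intro: order_tendstoD(2))

lemma eventually_M_less_right: "e > 0 \<Longrightarrow> eventually (\<lambda>t. M x y s t < e) at_bot"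
  using matching[of x y] unfolding matching_function_def limit_conditions_def
  by (auto intro: order_tendstoD(2))

lemma eventually_M_greater_left: "eventually (\<lambda>s. M x y s t > C) at_top"
  using matching[of x y] unfolding matching_function_def limit_conditions_def
  by (auto simp: filterlim_at_top_dense)

lemma eventually_M_greater_right: "eventually (\<lambda>t. M x y s t > C) at_top"
  using matching[of x y] unfolding matching_function_def limit_conditions_def
  by (auto simp: filterlim_at_top_dense)

lemma M_pos: "M x y s t > 0"
proof -
  have "((\<lambda>s. M x y s t) \<longlongrightarrow> 0) at_bot"
    using matching[of x y] unfolding matching_function_def limit_conditions_def by blast
  \<comment> \<open>Comparison with the limit 0 gives only a weak inequality; stopping at
    \<open>s - 1\<close> leaves room for the strict step up to \<open>s\<close>.\<close>
  moreover have "eventually (\<lambda>r. M x y r t \<le> M x y (s - 1) t) at_bot"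
    using eventually_le_at_bot[of "s - 1"] by eventually_elim (simp add: M_mono)
  ultimately have "0 \<le> M x y (s - 1) t"
    by (rule tendsto_upperbound) simp
  also have "\<dots> < M x y s t" by (simp add: M_less_left)
  finally show ?thesis .
qed

lemma sum_swap: "(\<Sum>x\<in>UNIV. \<Sum>y\<in>UNIV. M x y (a $ x) (b $ y))
    = (\<Sum>y\<in>UNIV. \<Sum>x\<in>UNIV. M x y (a $ x) (b $ y))"
  by (rule sum.swap)

section \<open>Comparison of solutions of the accounting equations\<close>

text \<open>Summing the rows and the columns gives total \<open>n\<close> \<le> total of
  \<open>M\<close> \<le> total \<open>m\<close>. Balance closes this chain, so no single inequality
  can be strict.\<close>

lemma accounting_if_le:
  assumes x: "\<And>x. n $ x \<le> (\<Sum>y\<in>UNIV. M x y (a $ x) (b $ y))"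
    and y: "\<And>y. (\<Sum>x\<in>UNIV. M x y (a $ x) (b $ y)) \<le> m $ y"
  shows "accounting_equations n m M a b"
proof -
  have "(\<Sum>x\<in>UNIV. n $ x) = (\<Sum>x\<in>UNIV. \<Sum>y\<in>UNIV. M x y (a $ x) (b $ y))"
    "(\<Sum>y\<in>UNIV. \<Sum>x\<in>UNIV. M x y (a $ x) (b $ y)) = (\<Sum>y\<in>UNIV. m $ y)"
    using sum_mono[of UNIV "($) n", OF x] sum_mono[of UNIV _ "($) m", OF y] balance sum_swap[of a b]
    by linarith+
  from sum_mono_inv[OF this(1) x] sum_mono_inv[OF this(2) y] show ?thesis
    unfolding accounting_equations_def by simp
qed

text \<open>If one coordinate \<open>x\<close> agrees, the two row sums at \<open>x\<close> are
  equal although their terms are ordered; so the terms agree, and strict isotonicity gives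
  \<open>b = v\<close>. Columns behave alike, so equality anywhere spreads to both sides.\<close>

lemma solutions_ordered_cases:
  assumes ab: "accounting_equations n m M a b" and uv: "accounting_equations n m M u v"
    and ua: "\<And>x. u $ x \<le> a $ x" and bv: "\<And>y. b $ y \<le> v $ y"
  shows "(a = u \<and> b = v) \<or> ((\<forall>x. u $ x < a $ x) \<and> (\<forall>y. b $ y < v $ y))"
proof -
  have 1: "b = v" if "a $ x = u $ x" for x
  proof -
    have "(\<Sum>y\<in>UNIV. M x y (a $ x) (b $ y)) = (\<Sum>y\<in>UNIV. M x y (a $ x) (v $ y))"
      using ab uv that unfolding accounting_equations_def by metis
    then have "M x y (a $ x) (b $ y) = M x y (a $ x) (v $ y)" for y
      by (rule sum_mono_inv) (auto intro: M_mono bv)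
    then show ?thesis
      unfolding vec_eq_iff by (metis M_less_right linorder_neqE order_less_irrefl)
  qed
  have 2: "a = u" if "b $ y = v $ y" for y
  proof -
    have "(\<Sum>x\<in>UNIV. M x y (u $ x) (b $ y)) = (\<Sum>x\<in>UNIV. M x y (a $ x) (b $ y))"
      using ab uv that unfolding accounting_equations_def by metis
    then have "M x y (u $ x) (b $ y) = M x y (a $ x) (b $ y)" for x
      by (rule sum_mono_inv) (auto intro: M_mono ua)
    then show ?thesis
      unfolding vec_eq_iff by (metis M_less_left linorder_neqE order_less_irrefl)
  qed
  show ?thesis
    using 1 2 ua bv by (metis order_le_less)
qed

lemma solutions_chain:
  assumes ab: "accounting_equations n m M a b" and ab': "accounting_equations n m M a' b'"
  shows "(a = a' \<and> b = b') \<or> ((\<forall>x. a' $ x < a $ x) \<and> (\<forall>y. b $ y < b' $ y))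
    \<or> ((\<forall>x. a $ x < a' $ x) \<and> (\<forall>y. b' $ y < b $ y))"
proof -
  \<comment> \<open>The pair \<open>(u, v)\<close> is the join in the prices
    \<open>(- a, b)\<close>. In each row, the solution attaining the minimum bounds the row sum
    below by \<open>n $ x\<close>; in each column, the one attaining the maximum bounds the column
    sum above by \<open>m $ y\<close>.\<close>
  define u :: "real ^ 'x" where "u = (\<chi> x. min (a $ x) (a' $ x))"
  define v :: "real ^ 'y" where "v = (\<chi> y. max (b $ y) (b' $ y))"
  have le: "u $ x \<le> a $ x" "u $ x \<le> a' $ x" "b $ y \<le> v $ y" "b' $ y \<le> v $ y" for x y
    by (simp_all add: u_def v_def)
  have uv: "accounting_equations n m M u v"
  proof (rule accounting_if_le)
    fix x
    show "n $ x \<le> (\<Sum>y\<in>UNIV. M x y (u $ x) (v $ y))"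
    proof (cases "a $ x \<le> a' $ x")
      case True
      then have "u $ x = a $ x" by (simp add: u_def)
      then show ?thesis using ab unfolding accounting_equations_def
        by (auto intro!: sum_mono M_mono le)
    next
      case False
      then have "u $ x = a' $ x" by (simp add: u_def)
      then show ?thesis using ab' unfolding accounting_equations_def
        by (auto intro!: sum_mono M_mono le)
    qed
  next
    fix y
    show "(\<Sum>x\<in>UNIV. M x y (u $ x) (v $ y)) \<le> m $ y"
    proof (cases "b' $ y \<le> b $ y")
      case True
      then have "v $ y = b $ y" by (simp add: v_def)
      then show ?thesis using ab unfolding accounting_equations_def
        by (auto intro!: sum_mono M_mono le)
    next
      case False
      then have "v $ y = b' $ y" by (simp add: v_def)
      then show ?thesis using ab' unfolding accounting_equations_def
        by (auto intro!: sum_mono M_mono le)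
    qed
  qed
  \<comment> \<open>Each solution equals the join or is strictly separated from it. Both cannot be
    separated, since \<open>u $ x\<close> is one of \<open>a $ x\<close> and
    \<open>a' $ x\<close>.\<close>
  show ?thesis
    using solutions_ordered_cases[OF ab uv le(1,3)]
      solutions_ordered_cases[OF ab' uv le(2,4)]
    unfolding u_def v_def vec_lambda_beta
    by (smt (verit, ccfv_threshold) vec_lambda_beta)
qed

section \<open>Existence of solutions with one prescribed fixed effect\<close>

text \<open>In the prices \<open>(- a, b)\<close> these are the points of nonnegative excess supply
  in every component but \<open>x0\<close>, whose price is fixed. The equation at \<open>x0\<close>
  is left out, to be recovered from balance.\<close>

definition supersolutions :: "'x \<Rightarrow> real \<Rightarrow> ((real ^ 'x) \<times> (real ^ 'y)) set" where
  "supersolutions x0 c = {(a, b). a $ x0 = c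
     \<and> (\<forall>x. x \<noteq> x0 \<longrightarrow> (\<Sum>y\<in>UNIV. M x y (a $ x) (b $ y)) \<le> n $ x)
     \<and> (\<forall>y. m $ y \<le> (\<Sum>x\<in>UNIV. M x y (a $ x) (b $ y)))}"

text \<open>First \<open>t\<close> is taken so high that \<open>x0\<close> alone fills every column;
  then, for this \<open>t\<close>, \<open>s\<close> so low that every other row stays below its
  mass.\<close>

lemma supersolutions_nonempty: "supersolutions x0 c \<noteq> {}"
proof -
  have "eventually (\<lambda>t. \<forall>y. M x0 y c t > m $ y) at_top"
    by (intro eventually_all_finite eventually_M_greater_right)
  then obtain t where t: "\<And>y. M x0 y c t > m $ y"
    using eventually_happens'[OF trivial_limit_at_top_linorder] by blast
  have "eventually (\<lambda>s. \<forall>x y. M x y s t < n $ x / real CARD('y)) at_bot"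
    using n_pos by (intro eventually_all_finite eventually_M_less_left) simp
  then obtain s where s: "\<And>x y. M x y s t < n $ x / real CARD('y)"
    using eventually_happens'[OF trivial_limit_at_bot_linorder] by blast
  define a :: "real ^ 'x" where "a = (\<chi> x. if x = x0 then c else s)"
  have "m $ y \<le> (\<Sum>x\<in>UNIV. M x y (a $ x) t)" for y
  proof -
    have "m $ y \<le> M x0 y (a $ x0) t" using t[of y] by (simp add: a_def)
    also have "\<dots> \<le> (\<Sum>x\<in>UNIV. M x y (a $ x) t)"
      by (rule member_le_sum) (auto intro: less_imp_le M_pos)
    finally show ?thesis .
  qed
  moreover have "(\<Sum>y\<in>UNIV. M x y s t) \<le> n $ x" for x
    using sum_less_if_less_div_card[OF s] by (rule less_imp_le)
  ultimately have "(a, \<chi> y. t) \<in> supersolutions x0 c"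
    by (simp add: supersolutions_def a_def)
  then show ?thesis by blast
qed

text \<open>Prices are bounded below. By balance the omitted row \<open>x0\<close> must reach at
  least \<open>n $ x0\<close>, so some \<open>b $ y1\<close> exceeds \<open>\<gamma>\<close>. The
  row bounds at \<open>y1\<close> then keep each \<open>a $ x\<close> below \<open>\<alpha>\<close>,
  and with that the column bounds keep each \<open>b $ y\<close> above
  \<open>\<beta>\<close>.\<close>

lemma supersolutions_bounded:
  "\<exists>\<alpha> \<beta>. \<forall>(a, b) \<in> supersolutions x0 c. (\<forall>x. a $ x \<le> \<alpha>) \<and> (\<forall>y. \<beta> \<le> b $ y)"
proof -
  have "eventually (\<lambda>t. \<forall>y. M x0 y c t < n $ x0 / real CARD('y)) at_bot"
    using n_pos by (intro eventually_all_finite eventually_M_less_right) simp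
  then obtain \<gamma> where \<gamma>: "\<And>y. M x0 y c \<gamma> < n $ x0 / real CARD('y)"
    using eventually_happens'[OF trivial_limit_at_bot_linorder] by blast
  \<comment> \<open>The clause \<open>c \<le> s\<close> covers the coordinate \<open>x0\<close>,
    which has no row bound.\<close>
  have "eventually (\<lambda>s. (\<forall>x y. M x y s \<gamma> > n $ x) \<and> c \<le> s) at_top"
    by (intro eventually_conj eventually_all_finite eventually_M_greater_left eventually_ge_at_top)
  then obtain \<alpha> where \<alpha>: "\<And>x y. M x y \<alpha> \<gamma> > n $ x" "c \<le> \<alpha>"
    using eventually_happens'[OF trivial_limit_at_top_linorder] by blast
  have "eventually (\<lambda>t. \<forall>y x. M x y \<alpha> t < m $ y / real CARD('x)) at_bot"
    using m_pos by (intro eventually_all_finite eventually_M_less_right) simp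
  then obtain \<beta> where \<beta>: "\<And>y x. M x y \<alpha> \<beta> < m $ y / real CARD('x)"
    using eventually_happens'[OF trivial_limit_at_bot_linorder] by blast
  have "(\<forall>x. a $ x \<le> \<alpha>) \<and> (\<forall>y. \<beta> \<le> b $ y)" if "(a, b) \<in> supersolutions x0 c" for a b
  proof -
    have c: "a $ x0 = c"
      and x: "\<And>x. x \<noteq> x0 \<Longrightarrow> (\<Sum>y\<in>UNIV. M x y (a $ x) (b $ y)) \<le> n $ x"
      and y: "\<And>y. m $ y \<le> (\<Sum>x\<in>UNIV. M x y (a $ x) (b $ y))"
      using that by (auto simp: supersolutions_def)
    have "(\<Sum>x\<in>UNIV. n $ x) \<le> (\<Sum>x\<in>UNIV. \<Sum>y\<in>UNIV. M x y (a $ x) (b $ y))"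
      using sum_mono[of UNIV "($) m", OF y] by (simp add: balance sum_swap)
    moreover have "(\<Sum>x\<in>UNIV - {x0}. \<Sum>y\<in>UNIV. M x y (a $ x) (b $ y))
        \<le> (\<Sum>x\<in>UNIV - {x0}. n $ x)"
      by (rule sum_mono) (simp add: x)
    ultimately have x0: "n $ x0 \<le> (\<Sum>y\<in>UNIV. M x0 y c (b $ y))"
      by (simp add: sum.remove[of UNIV x0] c)
    have "\<exists>y. \<gamma> < b $ y"
    proof (rule ccontr)
      assume "\<not> ?thesis"
      then have "M x0 y c (b $ y) < n $ x0 / real CARD('y)" for y
        by (intro order.strict_trans1[OF M_mono \<gamma>]) (auto simp: not_less)
      from sum_less_if_less_div_card[where f = "\<lambda>y. M x0 y c (b $ y)", OF this] x0
      show False by simp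
    qed
    then obtain y1 where y1: "\<gamma> < b $ y1" ..
    have a: "a $ x \<le> \<alpha>" for x
    proof (cases "x = x0")
      case True
      then show ?thesis using c \<alpha>(2) by simp
    next
      case False
      have "M x y1 (a $ x) (b $ y1) \<le> (\<Sum>y\<in>UNIV. M x y (a $ x) (b $ y))"
        by (rule member_le_sum) (auto intro: less_imp_le M_pos)
      also have "\<dots> \<le> n $ x" by (rule x[OF False])
      also have "\<dots> < M x y1 \<alpha> \<gamma>" by (rule \<alpha>)
      finally show ?thesis
        using M_mono[of \<alpha> "a $ x" \<gamma> "b $ y1" x y1] y1 by linarith
    qed
    have "\<beta> \<le> b $ y" for y
    proof (rule ccontr)
      assume "\<not> ?thesis"
      then have "M x y (a $ x) (b $ y) < m $ y / real CARD('x)" for x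
        by (intro order.strict_trans1[OF M_mono \<beta>]) (auto simp: a)
      from sum_less_if_less_div_card[where f = "\<lambda>x. M x y (a $ x) (b $ y)", OF this] y[of y]
      show False by simp
    qed
    with a show ?thesis by blast
  qed
  then show ?thesis by blast
qed

lemma closed_supersolutions: "closed (supersolutions x0 c)"
proof -
  have eq: "supersolutions x0 c = {p. fst p $ x0 = c}
     \<inter> (\<Inter>x\<in>- {x0}. {p. (\<Sum>y\<in>UNIV. M x y (fst p $ x) (snd p $ y)) \<le> n $ x})
     \<inter> (\<Inter>y. {p. m $ y \<le> (\<Sum>x\<in>UNIV. M x y (fst p $ x) (snd p $ y))})"
    by (auto simp: supersolutions_def)
  show ?thesis unfolding eq
    by (intro closed_Int closed_INT ballI closed_Collect_le closed_Collect_eq continuous_intros)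
qed

text \<open>A supersolution with minimal total price is a solution: a slack constraint would allow
  lowering one price.\<close>

lemma exists_solution_left: "\<exists>a b. accounting_equations n m M a b \<and> a $ x0 = c"
proof -
  let ?T = "supersolutions x0 c"
  obtain \<alpha> \<beta> where bd: "\<And>a b. (a, b) \<in> ?T \<Longrightarrow> (\<forall>x. a $ x \<le> \<alpha>) \<and> (\<forall>y. \<beta> \<le> b $ y)"
    using supersolutions_bounded[of x0 c] by blast
  obtain a0 b0 where ab0: "(a0, b0) \<in> ?T"
    using supersolutions_nonempty[of x0 c] by auto
  define D where "D = ?T \<inter> cbox (a0, \<chi> y. \<beta>) (\<chi> x. \<alpha>, b0)"
  \<comment> \<open>The lower price bounds hold for all supersolutions, so the box imposes only a
    price ceiling. Lowering a price therefore never leaves \<open>D\<close> as long as the result is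
    a supersolution.\<close>
  have D_iff: "(a, b) \<in> D \<longleftrightarrow> (a, b) \<in> ?T \<and> (\<forall>x. a0 $ x \<le> a $ x) \<and> (\<forall>y. b $ y \<le> b0 $ y)" for a b
    using bd[of a b] by (auto simp: D_def cbox_Pair_eq mem_box_cart)
  have "compact D"
    unfolding D_def by (intro closed_Int_compact closed_supersolutions compact_cbox)
  moreover have "D \<noteq> {}" using ab0 D_iff[of a0 b0] by auto
  moreover have "continuous_on D (\<lambda>p. (\<Sum>y\<in>UNIV. snd p $ y) - (\<Sum>x\<in>UNIV. fst p $ x))"
    by (intro continuous_intros)
  ultimately have "\<exists>p\<in>D. \<forall>q\<in>D.
      (\<Sum>y\<in>UNIV. snd p $ y) - (\<Sum>x\<in>UNIV. fst p $ x) \<le> (\<Sum>y\<in>UNIV. snd q $ y) - (\<Sum>x\<in>UNIV. fst q $ x)"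
    by (rule continuous_attains_inf)
  then obtain a b where abD: "(a, b) \<in> D"
    and minimal: "\<And>a' b'. (a', b') \<in> D \<Longrightarrow>
      (\<Sum>y\<in>UNIV. b $ y) - (\<Sum>x\<in>UNIV. a $ x) \<le> (\<Sum>y\<in>UNIV. b' $ y) - (\<Sum>x\<in>UNIV. a' $ x)"
    by fastforce
  have ab: "a $ x0 = c"
      "\<And>x. x \<noteq> x0 \<Longrightarrow> (\<Sum>y\<in>UNIV. M x y (a $ x) (b $ y)) \<le> n $ x"
      "\<And>y. m $ y \<le> (\<Sum>x\<in>UNIV. M x y (a $ x) (b $ y))"
    and box: "\<And>x. a0 $ x \<le> a $ x" "\<And>y. b $ y \<le> b0 $ y"
    using abD by (auto simp: D_iff supersolutions_def)
  have eq_x: "(\<Sum>y\<in>UNIV. M x y (a $ x) (b $ y)) = n $ x" if "x \<noteq> x0" for x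
  proof (rule ccontr)
    assume "\<not> ?thesis"
    then have "(\<Sum>y\<in>UNIV. M x y (a $ x) (b $ y)) < n $ x" using ab(2)[OF that] by simp
    moreover have "continuous_on UNIV (\<lambda>s. \<Sum>y\<in>UNIV. M x y s (b $ y))"
      by (intro continuous_intros)
    ultimately obtain s where s: "s > a $ x" "(\<Sum>y\<in>UNIV. M x y s (b $ y)) < n $ x"
      using exists_increase_below by blast
    \<comment> \<open>Raising \<open>a $ x\<close> leaves the other rows unchanged and only
      increases the column sums, so all constraints survive.\<close>
    define a' :: "real ^ 'x" where "a' = (\<chi> w. if w = x then s else a $ w)"
    have le: "a $ w \<le> a' $ w" for w using s(1) by (simp add: a'_def)
    have "m $ y \<le> (\<Sum>x\<in>UNIV. M x y (a' $ x) (b $ y))" for y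
      by (rule order_trans[OF ab(3)]) (intro sum_mono M_mono le order_refl)
    then have "(a', b) \<in> ?T"
      using ab(1,2) s(2) that by (auto simp: supersolutions_def a'_def)
    then have "(a', b) \<in> D" using box le by (auto simp: D_iff intro: order_trans)
    from minimal[OF this] have "(\<Sum>x\<in>UNIV. a' $ x) \<le> (\<Sum>x\<in>UNIV. a $ x)" by simp
    moreover have "(\<Sum>x\<in>UNIV. a $ x) < (\<Sum>x\<in>UNIV. a' $ x)"
      by (rule sum_strict_mono_ex1) (use le s(1) in \<open>auto simp: a'_def\<close>)
    ultimately show False by simp
  qed
  have eq_y: "(\<Sum>x\<in>UNIV. M x y (a $ x) (b $ y)) = m $ y" for y
  proof (rule ccontr)
    assume "\<not> ?thesis"
    then have "m $ y < (\<Sum>x\<in>UNIV. M x y (a $ x) (b $ y))" using ab(3)[of y] by simp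
    moreover have "continuous_on UNIV (\<lambda>t. \<Sum>x\<in>UNIV. M x y (a $ x) t)"
      by (intro continuous_intros)
    ultimately obtain t where t: "t < b $ y" "m $ y < (\<Sum>x\<in>UNIV. M x y (a $ x) t)"
      using exists_decrease_above by blast
    \<comment> \<open>Dually, lowering \<open>b $ y\<close> leaves the other columns unchanged and
      only decreases the row sums.\<close>
    define b' :: "real ^ 'y" where "b' = (\<chi> w. if w = y then t else b $ w)"
    have le: "b' $ w \<le> b $ w" for w using t(1) by (simp add: b'_def)
    have "(\<Sum>y\<in>UNIV. M x y (a $ x) (b' $ y)) \<le> n $ x" if "x \<noteq> x0" for x
      by (rule order_trans[OF _ ab(2)[OF that]]) (intro sum_mono M_mono le order_refl)
    then have "(a, b') \<in> ?T"
      using ab(1,3) t(2) by (auto simp: supersolutions_def b'_def)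
    then have "(a, b') \<in> D" using box le by (auto simp: D_iff intro: order_trans)
    from minimal[OF this] have "(\<Sum>y\<in>UNIV. b $ y) \<le> (\<Sum>y\<in>UNIV. b' $ y)" by simp
    moreover have "(\<Sum>y\<in>UNIV. b' $ y) < (\<Sum>y\<in>UNIV. b $ y)"
      by (rule sum_strict_mono_ex1) (use le t(1) in \<open>auto simp: b'_def\<close>)
    ultimately show False by simp
  qed
  \<comment> \<open>The totals agree by balance and all other rows hold with equality, which leaves
    exactly the omitted equation at \<open>x0\<close>.\<close>
  have "(\<Sum>x\<in>UNIV. \<Sum>y\<in>UNIV. M x y (a $ x) (b $ y)) = (\<Sum>x\<in>UNIV. n $ x)"
    by (simp add: sum_swap eq_y balance)
  then have "(\<Sum>y\<in>UNIV. M x0 y (a $ x0) (b $ y)) = n $ x0"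
    by (simp add: sum.remove[of UNIV x0] eq_x)
  then have "accounting_equations n m M a b"
    unfolding accounting_equations_def using eq_x eq_y by metis
  then show ?thesis using ab(1) by blast
qed

text \<open>The hypotheses are symmetric in the two sides, so existence with a prescribed
  \<open>a $ x0\<close> transfers to a prescribed \<open>b $ y0\<close>.\<close>

lemma swap_market: "matching_market m n (\<lambda>y x t s. M x y s t)"
proof
  fix y x
  have "continuous_on UNIV (\<lambda>p. M x y (snd p) (fst p))"
    by (intro continuous_intros)
  then show "matching_function (\<lambda>t s. M x y s t)"
    using matching[of x y]
    unfolding matching_function_def strictly_isotone_def limit_conditions_def
    by (auto simp: case_prod_unfold)
qed (auto simp: n_pos m_pos balance)

lemma exists_solution_right: "\<exists>a b. accounting_equations n m M a b \<and> b $ y0 = c"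
proof -
  interpret swap: matching_market m n "\<lambda>y x t s. M x y s t" by (rule swap_market)
  show ?thesis
    using swap.exists_solution_left[of y0 c] unfolding accounting_equations_def by blast
qed

section \<open>The chain of solution prices and the normalization\<close>

text \<open>The sign change turns the opposite orders on \<open>a\<close> and \<open>b\<close> into
  one coordinatewise order, as needed for \<open>normalization_hits_strict_chain\<close>.\<close>

definition solution_prices :: "(real ^ ('x + 'y)) set" where
  "solution_prices =
     {p. accounting_equations n m M (\<chi> x. - (p $ Inl x)) (\<chi> y. p $ Inr y)}"

lemma price_vector_mem_iff:
  "price_vector a b \<in> solution_prices \<longleftrightarrow> accounting_equations n m M a b"
  by (simp add: solution_prices_def price_vector_inverse)

lemma closed_solution_prices: "closed solution_prices"
  unfolding solution_prices_def accounting_equations_def vec_lambda_beta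
  by (intro closed_Collect_conj closed_Collect_all closed_Collect_eq continuous_intros)

lemma solution_prices_chain:
  assumes "p \<in> solution_prices" "q \<in> solution_prices"
  shows "p = q \<or> (\<forall>z. p $ z < q $ z) \<or> (\<forall>z. q $ z < p $ z)"
  using solutions_chain[OF assms[unfolded solution_prices_def mem_Collect_eq]]
  by (auto simp: vec_eq_iff all_sum)

lemma solution_prices_hit: "\<exists>p\<in>solution_prices. p $ z = d"
proof (cases z)
  case (Inl x)
  then show ?thesis using exists_solution_left[of x "- d"]
    by (metis (no_types, lifting) price_vector_mem_iff price_vector_def vec_lambda_beta
        sum.case(1) minus_minus)
next
  case (Inr y)
  then show ?thesis using exists_solution_right[of y d]
    by (metis (no_types, lifting) price_vector_mem_iff price_vector_def vec_lambda_beta sum.case(2))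
qed

context
  fixes \<psi> :: "real ^ ('x + 'y) \<Rightarrow> real" and L U :: ereal
  assumes \<psi>: "normalization_mapping \<psi> L U"
begin

lemma exists_normalized_solution: "\<exists>a b. normalized_system n m M \<psi> K a b"
  using normalization_hits_strict_chain[OF \<psi> closed_solution_prices
      solution_prices_chain solution_prices_hit, of K]
  unfolding normalized_system_def
  by (metis price_vector_mem_iff price_vector_of_effects)

text \<open>Distinct solutions are strictly ordered in every price, which would separate their
  values under \<open>\<psi>\<close>.\<close>

lemma normalized_solution_unique:
  assumes "normalized_system n m M \<psi> K a b" "normalized_system n m M \<psi> K a' b'"
  shows "a = a' \<and> b = b'"
proof -
  have "price_vector a b = price_vector a' b'"
    using assms solution_prices_chain[of "price_vector a b" "price_vector a' b'"]
      normalization_strict_mono[OF \<psi>]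
    unfolding normalized_system_def price_vector_mem_iff by (metis order_less_irrefl)
  then show ?thesis by (metis price_vector_inverse)
qed

text \<open>Of the three cases of the chain, equality and the reverse order contradict
  \<open>K < K'\<close>.\<close>

lemma normalized_solution_strict_mono:
  assumes ab: "normalized_system n m M \<psi> K a b" and ab': "normalized_system n m M \<psi> K' a' b'"
    and "K < K'"
  shows "a' $ x < a $ x" and "b $ y < b' $ y"
proof -
  have *: "price_vector a b $ z < price_vector a' b' $ z" for z
    using assms solution_prices_chain[of "price_vector a b" "price_vector a' b'"]
      normalization_strict_mono[OF \<psi>]
    unfolding normalized_system_def price_vector_mem_iff by (metis order_less_asym')
  show "a' $ x < a $ x" "b $ y < b' $ y"
    using *[of "Inl x"] *[of "Inr y"] by (simp_all add: price_vector_def)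
qed

text \<open>Summing the column equations over \<open>y\<close> yields the balance between
  \<open>m\<close> and \<open>\<mu>\<close>, so equilibria correspond to solutions of the
  system.\<close>

lemma normalized_equilibrium_iff:
  "normalized_equilibrium n m M \<psi> K \<mu> \<longleftrightarrow>
    (\<exists>a b. normalized_system n m M \<psi> K a b \<and> \<mu> = (\<lambda>x y. M x y (a $ x) (b $ y)))"
proof -
  have "equilibrium_with_effects n m M a b \<mu> \<longleftrightarrow>
      accounting_equations n m M a b \<and> \<mu> = (\<lambda>x y. M x y (a $ x) (b $ y))" for a b
    by (auto simp: equilibrium_with_effects_def fun_eq_iff balance sum_swap)
      (simp_all add: accounting_equations_def)
  then show ?thesis
    unfolding normalized_equilibrium_def normalized_system_def by blast
qed

end

end

theorem corollary3:
  fixes n :: "real ^ 'x::finite" and m :: "real ^ 'y::finite"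
    and M :: "'x \<Rightarrow> 'y \<Rightarrow> real \<Rightarrow> real \<Rightarrow> real"
    and \<psi> :: "real ^ ('x + 'y) \<Rightarrow> real" and L U :: ereal
  defines "I \<equiv> {K :: real. L < ereal K \<and> ereal K < U}"
  assumes "\<And>x. n $ x > 0" and "\<And>y. m $ y > 0"
    and "(\<Sum>x\<in>UNIV. n $ x) = (\<Sum>y\<in>UNIV. m $ y)"
    and "\<And>x y. matching_function (M x y)"
    and "normalization_mapping \<psi> L U"
  shows "\<exists>as bs.
    (\<forall>K\<in>I.
      (\<exists>!\<mu>. normalized_equilibrium n m M \<psi> K \<mu>) \<and>
      normalized_equilibrium n m M \<psi> K (\<lambda>x y. M x y (as K $ x) (bs K $ y)) \<and>
      normalized_system n m M \<psi> K (as K) (bs K) \<and>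
      (\<forall>a b. normalized_system n m M \<psi> K a b \<longrightarrow> a = as K \<and> b = bs K)) \<and>
    (\<forall>x. strict_antimono_on I (\<lambda>K. as K $ x)) \<and>
    (\<forall>y. strict_mono_on I (\<lambda>K. bs K $ y))"
proof -
  interpret matching_market n m M by unfold_locales fact+
  note \<psi> = \<open>normalization_mapping \<psi> L U\<close>
  obtain as bs where sys: "\<And>K. normalized_system n m M \<psi> K (as K) (bs K)"
    using exists_normalized_solution[OF \<psi>] by metis
  have uniq: "a = as K \<and> b = bs K" if "normalized_system n m M \<psi> K a b" for K a b
    using normalized_solution_unique[OF \<psi> that sys] .
  \<comment> \<open>Uniqueness of the fixed effects pins down \<open>\<mu>\<close>.\<close>
  have eq: "normalized_equilibrium n m M \<psi> K \<mu> \<longleftrightarrow>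
      \<mu> = (\<lambda>x y. M x y (as K $ x) (bs K $ y))" for K \<mu>
    using normalized_equilibrium_iff[OF \<psi>] sys uniq by metis
  show ?thesis
  proof (intro exI[of _ as] exI[of _ bs] conjI ballI allI impI)
    show "strict_antimono_on I (\<lambda>K. as K $ x)" for x
      by (auto intro!: monotone_onI normalized_solution_strict_mono[OF \<psi> sys sys])
    show "strict_mono_on I (\<lambda>K. bs K $ y)" for y
      by (auto intro!: strict_mono_onI normalized_solution_strict_mono[OF \<psi> sys sys])
  qed (use sys uniq eq in auto)
qed

end
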